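(* Let $0<\gamma\le 1$. Let $X$ be a quasi-Banach space, $Y$ a $\gamma$-Banach space and $T:X\to Y$ a bounded linear operator. Then $$f_k(T)\le 2^{1/\gamma-1}\|T\|\qquad\text{for all }k\in\mathbb N,$$ and the constant $2^{1/\gamma-1}$ is sharp.
   Context: All vector spaces are real. For $\gamma\in(0,1]$, a $\gamma$-norm on a vector space $X$ is a function $\|\cdot|X\|:X\to[0,\infty)$ that vanishes only at $0$, is absolutely homogeneous, and satisfies $\|x+y|X\|^\gamma\le\|x|X\|^\gamma+\|y|X\|^\gamma$ for all $x,y\in X$. A quasi-norm is defined in the same way, with this last inequality replaced by $\|x+y|X\|\le C(\|x|X\|+\|y|X\|)$ for some constant $C\ge1$. A $\gamma$-Banach space (resp. quasi-Banach space) is a vector space that is complete with respect to a given $\gamma$-norm (resp. quasi-norm). $B_X$ denotes the closed unit ball of $X$, and $\|T\|=\sup_{x\in B_X}\|Tx|Y\|$. For a bounded linear operator $T:X\to Y$ and $k\in\mathbb N=\{1,2,\dots\}$, the $k$-th (dyadic) inner entropy number $f_k(T)$ is the supremum of all $\varepsilon>0$ for which there are $x_1,\dots,x_{2^{k-1}+1}\in B_X$ with $\|Tx_i-Tx_j|Y\|\ge2\varepsilon$ for all distinct $i,j\in\{1,\dots,2^{k-1}+1\}$ (the supremum of the empty set being $0$). "Sharp" means that the constant is best possible, i.e. it cannot be replaced by a smaller one in the inequality. *)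

theory Defs
  imports "HOL-Analysis.Analysis" "HOL-Library.Function_Algebras"
begin

text \<open>
  A (quasi-)normed space is a pair of a linear subspace \<open>V\<close> of some type of sort
  \<^class>\<open>real_vector\<close> and a function \<open>N\<close>, the (quasi-)norm, of which only the values on \<open>V\<close>
  matter.  The norm of the type, if there is one, plays no role.
\<close>

definition homogeneous_definite_on :: "'a::real_vector set \<Rightarrow> ('a \<Rightarrow> real) \<Rightarrow> bool" where
  "homogeneous_definite_on V N \<longleftrightarrow>
     subspace V \<and>
     (\<forall>x\<in>V. 0 \<le> N x) \<and>
     (\<forall>x\<in>V. N x = 0 \<longrightarrow> x = 0) \<and>
     (\<forall>c. \<forall>x\<in>V. N (c *\<^sub>R x) = \<bar>c\<bar> * N x)"

definition gamma_norm_on :: "real \<Rightarrow> 'a::real_vector set \<Rightarrow> ('a \<Rightarrow> real) \<Rightarrow> bool" where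
  "gamma_norm_on \<gamma> V N \<longleftrightarrow>
     homogeneous_definite_on V N \<and>
     (\<forall>x\<in>V. \<forall>y\<in>V. N (x + y) powr \<gamma> \<le> N x powr \<gamma> + N y powr \<gamma>)"

definition quasi_norm_on :: "'a::real_vector set \<Rightarrow> ('a \<Rightarrow> real) \<Rightarrow> bool" where
  "quasi_norm_on V N \<longleftrightarrow>
     homogeneous_definite_on V N \<and>
     (\<exists>C\<ge>1. \<forall>x\<in>V. \<forall>y\<in>V. N (x + y) \<le> C * (N x + N y))"

definition complete_wrt :: "'a::real_vector set \<Rightarrow> ('a \<Rightarrow> real) \<Rightarrow> bool" where
  "complete_wrt V N \<longleftrightarrow>
     (\<forall>s :: nat \<Rightarrow> 'a.
        (\<forall>n. s n \<in> V) \<and> (\<forall>e>0. \<exists>M. \<forall>m\<ge>M. \<forall>n\<ge>M. N (s m - s n) < e)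
        \<longrightarrow> (\<exists>l\<in>V. (\<lambda>n. N (s n - l)) \<longlonglongrightarrow> 0))"

definition gamma_Banach :: "real \<Rightarrow> 'a::real_vector set \<Rightarrow> ('a \<Rightarrow> real) \<Rightarrow> bool" where
  "gamma_Banach \<gamma> V N \<longleftrightarrow> gamma_norm_on \<gamma> V N \<and> complete_wrt V N"

definition quasi_Banach :: "'a::real_vector set \<Rightarrow> ('a \<Rightarrow> real) \<Rightarrow> bool" where
  "quasi_Banach V N \<longleftrightarrow> quasi_norm_on V N \<and> complete_wrt V N"

definition unit_ball :: "'a set \<Rightarrow> ('a \<Rightarrow> real) \<Rightarrow> 'a set" where
  "unit_ball V N = {x \<in> V. N x \<le> 1}"

definition bounded_operator ::
  "'a::real_vector set \<Rightarrow> ('a \<Rightarrow> real) \<Rightarrow> 'b::real_vector set \<Rightarrow> ('b \<Rightarrow> real) \<Rightarrow> ('a \<Rightarrow> 'b) \<Rightarrow> bool"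
where
  "bounded_operator V N W M T \<longleftrightarrow>
     (\<forall>x\<in>V. T x \<in> W) \<and>
     (\<forall>x\<in>V. \<forall>y\<in>V. T (x + y) = T x + T y) \<and>
     (\<forall>c. \<forall>x\<in>V. T (c *\<^sub>R x) = c *\<^sub>R T x) \<and>
     (\<exists>K. \<forall>x\<in>V. M (T x) \<le> K * N x)"

text \<open>
  The set below is nonempty because of \<open>0\<close>, and bounded above if \<open>T\<close> is a bounded operator.
\<close>

definition op_norm :: "'a set \<Rightarrow> ('a \<Rightarrow> real) \<Rightarrow> ('b \<Rightarrow> real) \<Rightarrow> ('a \<Rightarrow> 'b) \<Rightarrow> real" where
  "op_norm V N M T = (SUP x\<in>unit_ball V N. M (T x))"

definition separation_radii ::
  "'a set \<Rightarrow> ('a \<Rightarrow> real) \<Rightarrow> ('b::real_vector \<Rightarrow> real) \<Rightarrow> ('a \<Rightarrow> 'b) \<Rightarrow> nat \<Rightarrow> real set"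
where
  "separation_radii V N M T k =
     {e. 0 < e \<and>
         (\<exists>x :: nat \<Rightarrow> 'a.
            (\<forall>i\<in>{1..2 ^ (k - 1) + 1}. x i \<in> unit_ball V N) \<and>
            (\<forall>i\<in>{1..2 ^ (k - 1) + 1}. \<forall>j\<in>{1..2 ^ (k - 1) + 1}.
               i \<noteq> j \<longrightarrow> 2 * e \<le> M (T (x i) - T (x j))))}"

text \<open>
  The case distinction is needed because \<open>Sup {}\<close> is unspecified on the reals.  For a bounded
  operator between quasi-normed spaces the set of radii is bounded above, so that \<open>Sup\<close> is the
  true supremum.  The dyadic index \<open>k\<close> is meant to be positive.
\<close>

definition inner_entropy_number ::
  "'a set \<Rightarrow> ('a \<Rightarrow> real) \<Rightarrow> ('b::real_vector \<Rightarrow> real) \<Rightarrow> ('a \<Rightarrow> 'b) \<Rightarrow> nat \<Rightarrow> real"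
where
  "inner_entropy_number V N M T k =
     (if separation_radii V N M T k = {} then 0 else Sup (separation_radii V N M T k))"

text \<open>
  Real sequences with the pointwise operations form a real vector space, so that its subspaces
  can carry sequence spaces.
\<close>

instantiation "fun" :: (type, real_vector) real_vector
begin

definition scaleR_fun :: "real \<Rightarrow> ('a \<Rightarrow> 'b) \<Rightarrow> 'a \<Rightarrow> 'b" where
  "scaleR_fun c f = (\<lambda>x. c *\<^sub>R f x)"

instance
  by standard (simp_all add: scaleR_fun_def fun_eq_iff scaleR_add_right scaleR_add_left)

end

end

theory Submission
  imports Defs
begin

text \<open>
  Two points of the image of the unit ball have \<open>\<gamma>\<close>-norm at most \<open>\<parallel>T\<parallel>\<close> each, so their distance is
  at most \<open>2 powr (1/\<gamma>) * \<parallel>T\<parallel>\<close>; halving gives the bound.  Equality holds for the identity of the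
  \<open>2 ^ (k - 1) + 1\<close>-dimensional space \<open>\<ell>\<^sub>\<gamma>\<close>, because distinct unit vectors have distance exactly
  \<open>2 powr (1/\<gamma>)\<close>.
\<close>

section \<open>Powers, roots and the passage from \<gamma>-norms to quasi-norms\<close>

lemma powr_add_le:
  fixes a b p :: real
  assumes "0 \<le> a" "0 \<le> b" "0 < p" "p \<le> 1"
  shows "(a + b) powr p \<le> a powr p + b powr p"
proof (cases "a + b = 0")
  case True
  then show ?thesis using assms by simp
next
  case False
  define s where "s = a + b"
  have s: "s > 0" using False assms by (simp add: s_def)
  \<comment> \<open>A number in [0,1] only grows when raised to a power \<open>p \<le> 1\<close>.
    This is applied to the fractions \<open>a / s\<close> and \<open>b / s\<close>, which add up to
    1.\<close>
  have frac: "t * s powr p \<le> (t * s) powr p" if "0 \<le> t" "t \<le> 1" for t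
  proof -
    have "t \<le> t powr p"
    proof (cases "t = 0")
      case False
      then have "t powr 1 \<le> t powr p"
        using that assms by (intro powr_mono') auto
      then show ?thesis using that by simp
    qed auto
    then show ?thesis using that s by (simp add: powr_mult mult_right_mono)
  qed
  have "s powr p = (a / s) * s powr p + (b / s) * s powr p"
    using s by (simp add: s_def add_divide_distrib[symmetric] distrib_right[symmetric])
  also have "\<dots> \<le> (a / s * s) powr p + (b / s * s) powr p"
    using s assms by (intro add_mono frac) (auto simp: s_def)
  finally show ?thesis using s by (simp add: s_def)
qed

lemma powr_le_powr_imp_le:
  fixes a b p :: real
  assumes "a powr p \<le> b powr p" "0 < p" "0 \<le> b"
  shows "a \<le> b"
  using assms powr_less_mono2[of p b a] by (meson not_less)

text \<open>Each of \<open>N x powr p\<close> and \<open>N y powr p\<close> is at most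
  \<open>(N x + N y) powr p\<close>, and a \<open>p\<close>-th root turns the factor 2 into
  \<open>2 powr (1 / p)\<close>. Any constant will do here; the lemma lets the extremal space serve
  as a quasi-Banach domain.\<close>

lemma quasi_norm_on_if_gamma_norm_on:
  assumes "0 < p" and N: "gamma_norm_on p V N"
  shows "quasi_norm_on V N"
proof -
  have hom: "homogeneous_definite_on V N"
    using N by (simp add: gamma_norm_on_def)
  have "N (x + y) \<le> 2 powr (1 / p) * (N x + N y)" if "x \<in> V" "y \<in> V" for x y
  proof -
    have nonneg: "0 \<le> N x" "0 \<le> N y" "0 \<le> N (x + y)"
      using hom that by (auto simp: homogeneous_definite_on_def subspace_add)
    have "N (x + y) powr p \<le> N x powr p + N y powr p"
      using N that by (simp add: gamma_norm_on_def)
    also have "\<dots> \<le> 2 * (N x + N y) powr p"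
      using nonneg assms powr_mono2[of p "N x" "N x + N y"] powr_mono2[of p "N y" "N x + N y"]
      by simp
    also have "\<dots> = (2 powr (1 / p) * (N x + N y)) powr p"
      using nonneg assms by (simp add: powr_mult powr_powr)
    finally show ?thesis
      by (rule powr_le_powr_imp_le) (use nonneg assms in auto)
  qed
  moreover have "(1::real) \<le> 2 powr (1 / p)"
    using assms by (simp add: ge_one_powr_ge_zero)
  ultimately show ?thesis
    using hom by (auto simp: quasi_norm_on_def)
qed

section \<open>The upper bound for inner entropy numbers\<close>

lemma op_norm_upper:
  assumes "homogeneous_definite_on V N" "bounded_operator V N W M T" "x \<in> unit_ball V N"
  shows "M (T x) \<le> op_norm V N M T"
proof -
  obtain K where K: "\<And>x. x \<in> V \<Longrightarrow> M (T x) \<le> K * N x"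
    using assms(2) unfolding bounded_operator_def by blast
  \<comment> \<open>The absolute value is taken because \<open>K\<close> comes without a
    sign.\<close>
  have "M (T z) \<le> \<bar>K\<bar>" if "z \<in> unit_ball V N" for z
  proof -
    have "z \<in> V" "N z \<le> 1" "0 \<le> N z"
      using that assms by (auto simp: unit_ball_def homogeneous_definite_on_def)
    then have "K * N z \<le> \<bar>K\<bar> * 1" by (intro mult_mono) auto
    with K[OF \<open>z \<in> V\<close>] show ?thesis by simp
  qed
  then have "bdd_above ((\<lambda>x. M (T x)) ` unit_ball V N)" by (rule bdd_aboveI2)
  then show ?thesis
    unfolding op_norm_def using assms by (intro cSUP_upper) auto
qed

lemma op_norm_nonneg:
  assumes N: "homogeneous_definite_on V N" and M: "homogeneous_definite_on W M"
    and T: "bounded_operator V N W M T"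
  shows "0 \<le> op_norm V N M T"
proof -
  have "0 \<in> V" using N by (simp add: homogeneous_definite_on_def subspace_0)
  \<comment> \<open>Definiteness is stated in one direction only; \<open>N 0 = 0\<close> comes from
    homogeneity with the scalar 0.\<close>
  then have "N (0 *\<^sub>R 0) = \<bar>0\<bar> * N 0"
    using N unfolding homogeneous_definite_on_def by blast
  with \<open>0 \<in> V\<close> have z: "0 \<in> unit_ball V N" by (simp add: unit_ball_def)
  have "0 \<le> M (T 0)"
    using M T \<open>0 \<in> V\<close> by (auto simp: homogeneous_definite_on_def bounded_operator_def)
  also have "\<dots> \<le> op_norm V N M T" by (rule op_norm_upper[OF N T z])
  finally show ?thesis .
qed

lemma separation_radius_le:
  assumes p: "0 < p" and N: "homogeneous_definite_on V N" and M: "gamma_norm_on p W M"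
    and T: "bounded_operator V N W M T" and e: "e \<in> separation_radii V N M T k"
  shows "e \<le> 2 powr (1 / p - 1) * op_norm V N M T"
proof -
  let ?n = "2 ^ (k - 1) + 1 :: nat"
  have homM: "homogeneous_definite_on W M" using M by (simp add: gamma_norm_on_def)
  obtain x where x: "\<forall>i\<in>{1..?n}. x i \<in> unit_ball V N"
    and sep: "\<forall>i\<in>{1..?n}. \<forall>j\<in>{1..?n}. i \<noteq> j \<longrightarrow> 2 * e \<le> M (T (x i) - T (x j))"
    and "0 < e"
    using e by (auto simp: separation_radii_def)
  \<comment> \<open>Since \<open>2 ^ (k - 1) \<ge> 1\<close>, two indices exist for every
    \<open>k\<close>, and one separated pair already gives a bound independent of
    \<open>k\<close>.\<close>
  have idx: "1 \<in> {1..?n}" "2 \<in> {1..?n}" by auto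
  have ub: "x 1 \<in> unit_ball V N" "x 2 \<in> unit_ball V N" using x idx by blast+
  have W: "T (x 1) \<in> W" "T (x 2) \<in> W"
    using ub T by (auto simp: unit_ball_def bounded_operator_def)
  have subW: "subspace W" using homM by (simp add: homogeneous_definite_on_def)
  have minus: "- T (x 2) \<in> W" using subW W by (simp add: subspace_neg)
  have "M ((- 1) *\<^sub>R T (x 2)) = \<bar>- 1\<bar> * M (T (x 2))"
    using homM W unfolding homogeneous_definite_on_def by blast
  then have Mminus: "M (- T (x 2)) = M (T (x 2))" by simp
  have nonneg: "0 \<le> M (T (x 1))" "0 \<le> M (T (x 2))"
    using homM W by (auto simp: homogeneous_definite_on_def)
  have L: "0 \<le> op_norm V N M T" by (rule op_norm_nonneg[OF N homM T])
  have "2 * e \<le> M (T (x 1) + - T (x 2))"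
    using bspec[OF bspec[OF sep idx(1)] idx(2)] by simp
  then have "(2 * e) powr p \<le> M (T (x 1) + - T (x 2)) powr p"
    using \<open>0 < e\<close> p by (intro powr_mono2) auto
  also have "\<dots> \<le> M (T (x 1)) powr p + M (- T (x 2)) powr p"
    using M W(1) minus unfolding gamma_norm_on_def by blast
  also have "\<dots> \<le> op_norm V N M T powr p + op_norm V N M T powr p"
    unfolding Mminus using p nonneg op_norm_upper[OF N T] ub
    by (intro add_mono powr_mono2) auto
  also have "\<dots> = (2 powr (1 / p) * op_norm V N M T) powr p"
    using L p by (simp add: powr_mult powr_powr)
  finally have "2 * e \<le> 2 powr (1 / p) * op_norm V N M T"
    by (rule powr_le_powr_imp_le) (use L p in auto)
  then show ?thesis by (simp add: powr_diff)
qed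

lemma inner_entropy_number_le:
  assumes "0 < p" "homogeneous_definite_on V N" "gamma_norm_on p W M" "bounded_operator V N W M T"
  shows "inner_entropy_number V N M T k \<le> 2 powr (1 / p - 1) * op_norm V N M T"
proof -
  \<comment> \<open>This covers the default value 0 taken when there are no separation
    radii.\<close>
  have "0 \<le> op_norm V N M T"
    using assms by (intro op_norm_nonneg) (auto simp: gamma_norm_on_def)
  then show ?thesis
    using assms
    by (auto simp: inner_entropy_number_def intro!: cSup_least separation_radius_le)
qed

section \<open>Finite-dimensional l_p spaces\<close>

definition supported_on :: "'i set \<Rightarrow> ('i \<Rightarrow> real) set" where
  "supported_on A = {f. \<forall>i. i \<notin> A \<longrightarrow> f i = 0}"

definition lp_norm :: "real \<Rightarrow> 'i set \<Rightarrow> ('i \<Rightarrow> real) \<Rightarrow> real" where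
  "lp_norm p A f = (\<Sum>i\<in>A. \<bar>f i\<bar> powr p) powr (1 / p)"

lemma lp_norm_powr: "0 < p \<Longrightarrow> lp_norm p A f powr p = (\<Sum>i\<in>A. \<bar>f i\<bar> powr p)"
  by (simp add: lp_norm_def powr_powr sum_nonneg)

text \<open>A single term is at most the whole sum. This yields definiteness of the norm and reduces
  Cauchy sequences to their coordinates.\<close>

lemma abs_le_lp_norm:
  assumes "finite A" "0 < p" "i \<in> A"
  shows "\<bar>f i\<bar> \<le> lp_norm p A f"
proof -
  have "\<bar>f i\<bar> powr p \<le> (\<Sum>i\<in>A. \<bar>f i\<bar> powr p)"
    using assms by (intro member_le_sum) auto
  then have "(\<bar>f i\<bar> powr p) powr (1 / p) \<le> lp_norm p A f"
    unfolding lp_norm_def using assms by (intro powr_mono2) auto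
  then show ?thesis using assms by (simp add: powr_powr)
qed

text \<open>The \<open>p\<close>-th power of the norm is a plain sum, so the triangle inequality
  reduces to subadditivity of \<open>t powr p\<close> in each coordinate.\<close>

lemma gamma_norm_on_lp:
  assumes A: "finite A" and p: "0 < p" "p \<le> 1"
  shows "gamma_norm_on p (supported_on A) (lp_norm p A)"
proof -
  have "subspace (supported_on A)"
    by (auto simp: subspace_def supported_on_def scaleR_fun_def)
  moreover have "f = 0" if "f \<in> supported_on A" "lp_norm p A f = 0" for f
  proof
    fix i
    show "f i = 0 i"
      using that abs_le_lp_norm[OF A p(1), of i f] by (cases "i \<in> A") (auto simp: supported_on_def)
  qed
  moreover have "lp_norm p A (c *\<^sub>R f) = \<bar>c\<bar> * lp_norm p A f" for c f
  proof -
    have "(\<Sum>i\<in>A. \<bar>(c *\<^sub>R f) i\<bar> powr p) = \<bar>c\<bar> powr p * (\<Sum>i\<in>A. \<bar>f i\<bar> powr p)"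
      by (simp add: scaleR_fun_def abs_mult powr_mult sum_distrib_left)
    then show ?thesis
      using p by (simp add: lp_norm_def powr_mult powr_powr sum_nonneg)
  qed
  moreover have "lp_norm p A (f + g) powr p \<le> lp_norm p A f powr p + lp_norm p A g powr p" for f g
  proof -
    have "\<bar>f i + g i\<bar> powr p \<le> \<bar>f i\<bar> powr p + \<bar>g i\<bar> powr p" for i
      using powr_mono2[of p "\<bar>f i + g i\<bar>" "\<bar>f i\<bar> + \<bar>g i\<bar>"] powr_add_le[of "\<bar>f i\<bar>" "\<bar>g i\<bar>" p] p
      by linarith
    then show ?thesis
      using p by (simp add: lp_norm_powr sum.distrib[symmetric] sum_mono)
  qed
  ultimately show ?thesis
    by (auto simp: gamma_norm_on_def homogeneous_definite_on_def lp_norm_def)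
qed

text \<open>Coordinates of a Cauchy sequence converge in the reals; as \<open>A\<close> is finite,
  convergence in each coordinate gives convergence in norm.\<close>

lemma complete_wrt_lp:
  assumes A: "finite A" and p: "0 < p"
  shows "complete_wrt (supported_on A) (lp_norm p A)"
  unfolding complete_wrt_def
proof (intro allI impI)
  fix s :: "nat \<Rightarrow> 'a \<Rightarrow> real"
  assume s: "(\<forall>n. s n \<in> supported_on A) \<and>
    (\<forall>e>0. \<exists>M. \<forall>m\<ge>M. \<forall>n\<ge>M. lp_norm p A (s m - s n) < e)"
  have "convergent (\<lambda>n. s n i)" if "i \<in> A" for i
  proof -
    have "Cauchy (\<lambda>n. s n i)"
    proof (rule metric_CauchyI)
      fix e :: real assume "0 < e"
      then obtain M where M: "\<forall>m\<ge>M. \<forall>n\<ge>M. lp_norm p A (s m - s n) < e" using s by blast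
      have "dist (s m i) (s n i) < e" if "m \<ge> M" "n \<ge> M" for m n
        using abs_le_lp_norm[OF A p \<open>i \<in> A\<close>, of "s m - s n"] M that
        by (force simp: dist_real_def)
      then show "\<exists>M. \<forall>m\<ge>M. \<forall>n\<ge>M. dist (s m i) (s n i) < e" by blast
    qed
    then show ?thesis by (rule Cauchy_convergent)
  qed
  then have lim: "(\<lambda>n. s n i) \<longlonglongrightarrow> lim (\<lambda>n. s n i)" if "i \<in> A" for i
    using that by (simp add: convergent_LIMSEQ_iff)
  \<comment> \<open>The value 0 off \<open>A\<close> keeps the limit inside the subspace.\<close>
  define l where "l i = (if i \<in> A then lim (\<lambda>n. s n i) else 0)" for i
  have "(\<lambda>n. \<bar>s n i - l i\<bar> powr p) \<longlonglongrightarrow> 0" if "i \<in> A" for i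
  proof -
    have "(\<lambda>n. \<bar>s n i - l i\<bar>) \<longlonglongrightarrow> 0"
      using lim[OF that] that LIM_zero[of "\<lambda>n. s n i" "l i"]
      by (auto simp: l_def intro!: tendsto_rabs_zero)
    then show ?thesis
      by (rule tendsto_zero_powrI[where b = p]) (use p in auto)
  qed
  then have "(\<lambda>n. \<Sum>i\<in>A. \<bar>s n i - l i\<bar> powr p) \<longlonglongrightarrow> 0"
    by (intro tendsto_null_sum) auto
  then have "(\<lambda>n. lp_norm p A (s n - l)) \<longlonglongrightarrow> 0"
    unfolding lp_norm_def
    by (intro tendsto_zero_powrI[where b = "1 / p"]) (use p in \<open>auto simp: sum_nonneg\<close>)
  moreover have "l \<in> supported_on A" by (simp add: supported_on_def l_def)
  ultimately show "\<exists>l\<in>supported_on A. (\<lambda>n. lp_norm p A (s n - l)) \<longlonglongrightarrow> 0" by blast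
qed

section \<open>Unit vectors and the extremal identity operator\<close>

lemma lp_norm_unit_vector:
  assumes "finite A" "i \<in> A"
  shows "lp_norm p A (indicator {i}) = 1"
proof -
  have "(\<Sum>m\<in>A. \<bar>indicator {i} m\<bar> powr p) = (\<Sum>m\<in>{i}. 1 :: real)"
    using assms by (intro sum.mono_neutral_cong_right) (auto simp: indicator_def)
  then show ?thesis by (simp add: lp_norm_def)
qed

lemma lp_norm_unit_vector_diff:
  assumes "finite A" "i \<in> A" "j \<in> A" "i \<noteq> j"
  shows "lp_norm p A (indicator {i} - indicator {j}) = 2 powr (1 / p)"
proof -
  \<comment> \<open>The entries are 1 at \<open>i\<close> and -1 at \<open>j\<close>; all other
    terms are \<open>0 powr p\<close>, which is 0.\<close>
  have "(\<Sum>m\<in>A. \<bar>(indicator {i} - indicator {j}) m\<bar> powr p) = (\<Sum>m\<in>{i, j}. 1 :: real)"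
    using assms by (intro sum.mono_neutral_cong_right) (auto simp: indicator_def)
  then show ?thesis using assms by (simp add: lp_norm_def)
qed

text \<open>The dimension equals the number of points required, so the unit vectors themselves form
  the separated family, with radius half of their common distance
  \<open>2 powr (1 / p)\<close>.\<close>

lemma inner_entropy_number_id_lp:
  fixes p :: real and k :: nat
  defines "A \<equiv> {1..2 ^ (k - 1) + 1 :: nat}"
  assumes p: "0 < p" "p \<le> 1"
  shows "op_norm (supported_on A) (lp_norm p A) (lp_norm p A) id = 1" (is "?L = 1")
    and "2 powr (1 / p - 1) \<le> inner_entropy_number (supported_on A) (lp_norm p A) (lp_norm p A) id k"
proof -
  let ?V = "supported_on A" and ?N = "lp_norm p A"
  have A: "finite A" by (simp add: A_def)
  have N: "gamma_norm_on p ?V ?N" by (rule gamma_norm_on_lp[OF A p])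
  then have hom: "homogeneous_definite_on ?V ?N" by (simp add: gamma_norm_on_def)
  have T: "bounded_operator ?V ?N ?V ?N id"
    by (auto simp: bounded_operator_def intro: exI[of _ 1])
  have ball: "indicator {i} \<in> unit_ball ?V ?N" if "i \<in> A" for i
    using that A by (auto simp: unit_ball_def supported_on_def lp_norm_unit_vector indicator_def)
  have "1 \<in> A" by (simp add: A_def)
  have "?L \<le> 1"
    unfolding op_norm_def using ball[OF \<open>1 \<in> A\<close>]
    by (intro cSUP_least) (auto simp: unit_ball_def)
  moreover have "1 \<le> ?L"
    using op_norm_upper[OF hom T ball[OF \<open>1 \<in> A\<close>]] A \<open>1 \<in> A\<close> by (simp add: lp_norm_unit_vector)
  ultimately show "?L = 1" by simp
  have "2 * 2 powr (1 / p - 1) = (2 powr (1 / p) :: real)" by (simp add: powr_diff)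
  then have mem: "2 powr (1 / p - 1) \<in> separation_radii ?V ?N ?N id k"
    unfolding separation_radii_def A_def[symmetric] using ball A
    by (auto simp: lp_norm_unit_vector_diff intro!: exI[of _ "\<lambda>i. indicator {i}"])
  \<comment> \<open>A member bounds \<open>Sup\<close> from below only if the set is bounded above;
    the general upper bound supplies this.\<close>
  moreover have "bdd_above (separation_radii ?V ?N ?N id k)"
    using separation_radius_le[OF p(1) hom N T] by (rule bdd_aboveI)
  ultimately have "2 powr (1 / p - 1) \<le> Sup (separation_radii ?V ?N ?N id k)"
    by (rule cSup_upper)
  with mem show "2 powr (1 / p - 1) \<le> inner_entropy_number ?V ?N ?N id k"
    by (auto simp: inner_entropy_number_def)
qed

text \<open>Sharpness is expressed for each \<open>k\<close> separately: no smaller \<open>c\<close>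
  works even for that single index. Functions on \<open>nat\<close> can host a space whose dimension
  varies with \<open>k\<close>.\<close>

theorem theorem2:
  fixes \<gamma> :: real
  assumes "0 < \<gamma>" and "\<gamma> \<le> 1"
  shows
    "(\<forall>(X :: 'a::real_vector set) NX (Y :: 'b::real_vector set) NY T.
        quasi_Banach X NX \<and> gamma_Banach \<gamma> Y NY \<and> bounded_operator X NX Y NY T \<longrightarrow>
        (\<forall>k\<ge>1. inner_entropy_number X NX NY T k \<le> 2 powr (1 / \<gamma> - 1) * op_norm X NX NY T))
     \<and>
     (\<forall>k\<ge>1. \<forall>c < 2 powr (1 / \<gamma> - 1).
        \<exists>(X :: (nat \<Rightarrow> real) set) NX (Y :: (nat \<Rightarrow> real) set) NY T.
          quasi_Banach X NX \<and> gamma_Banach \<gamma> Y NY \<and> bounded_operator X NX Y NY T \<and>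
          c * op_norm X NX NY T < inner_entropy_number X NX NY T k)"
proof (intro conjI allI impI)
  fix X :: "'a set" and NX and Y :: "'b set" and NY T and k :: nat
  assume "quasi_Banach X NX \<and> gamma_Banach \<gamma> Y NY \<and> bounded_operator X NX Y NY T"
  then show "inner_entropy_number X NX NY T k \<le> 2 powr (1 / \<gamma> - 1) * op_norm X NX NY T"
    using assms(1)
    by (intro inner_entropy_number_le[where W = Y])
      (auto simp: quasi_Banach_def gamma_Banach_def quasi_norm_on_def)
next
  fix k :: nat and c :: real
  assume c: "c < 2 powr (1 / \<gamma> - 1)"
  define A where "A = {1..2 ^ (k - 1) + 1 :: nat}"
  let ?V = "supported_on A" and ?N = "lp_norm \<gamma> A"
  have A: "finite A" by (simp add: A_def)
  have N: "gamma_norm_on \<gamma> ?V ?N" and compl: "complete_wrt ?V ?N"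
    using gamma_norm_on_lp complete_wrt_lp A assms by blast+
  have "quasi_Banach ?V ?N" "gamma_Banach \<gamma> ?V ?N"
    using N compl quasi_norm_on_if_gamma_norm_on[OF assms(1) N]
    by (simp_all add: quasi_Banach_def gamma_Banach_def)
  moreover have "bounded_operator ?V ?N ?V ?N id"
    by (auto simp: bounded_operator_def intro: exI[of _ 1])
  \<comment> \<open>The identity has norm 1, so the left side is just \<open>c\<close>.\<close>
  moreover have "c * op_norm ?V ?N ?N id < inner_entropy_number ?V ?N ?N id k"
    using c inner_entropy_number_id_lp[OF assms, of k] unfolding A_def by simp
  ultimately show "\<exists>(X :: (nat \<Rightarrow> real) set) NX (Y :: (nat \<Rightarrow> real) set) NY T.
      quasi_Banach X NX \<and> gamma_Banach \<gamma> Y NY \<and> bounded_operator X NX Y NY T \<and>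
      c * op_norm X NX NY T < inner_entropy_number X NX NY T k"
    by blast
qed

end
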